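(* Let $\Theta:\mathcal X\to(-\infty,\infty]$ be a proper, lower semi-continuous function that is strongly convex with constant $c_0>0$ (in the sense given in the context). Let $\{\alpha_n\}$ be a decreasing sequence of positive numbers, let $0<\mu_0<4c_0$ and $\mu_1>0$, let $\xi_0\in\mathcal X$, and let $\{\xi_n\},\{x_n\}\subset\mathcal X$ be generated from $\xi_0$ by the exact-data iteration described in the context, with the step sizes $t_n$ given there. Then $$\lim_{n\to\infty}\|x_n-x^\dagger\|=0\quad\text{and}\quad \lim_{n\to\infty}D_{\xi_n}\Theta(x^\dagger,x_n)=0 .$$
   Context: $\mathcal X,\mathcal Y$ are (real) Hilbert spaces, $A:\mathcal X\to\mathcal Y$ is a bounded linear operator with adjoint $A^*$, $I$ is the identity on $\mathcal Y$, and $y\in\mathcal Y$. For $\Theta:\mathcal X\to(-\infty,\infty]$ put $\mathscr D(\Theta)=\{x\in\mathcal X:\Theta(x)<\infty\}$; $\Theta$ is proper if $\mathscr D(\Theta)\neq\emptyset$. It is assumed throughout that the equation $Ax=y$ has a solution in $\mathscr D(\Theta)$. Strong convexity with constant $c_0>0$ means $$\Theta(s\bar x+(1-s)x)+c_0s(1-s)\|\bar x-x\|^2\le s\Theta(\bar x)+(1-s)\Theta(x)\quad\text{for all }0\le s\le1,\ \bar x,x\in\mathcal X.$$ The subdifferential is $\partial\Theta(x)=\{\xi\in\mathcal X:\Theta(\bar x)-\Theta(x)-\langle\xi,\bar x-x\rangle\ge0\ \forall\bar x\in\mathcal X\}$, and for $\xi\in\partial\Theta(x)$ the Bregman distance is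 $D_\xi\Theta(\bar x,x)=\Theta(\bar x)-\Theta(x)-\langle\xi,\bar x-x\rangle$. Exact-data iteration: given $\xi_0\in\mathcal X$, set $x_0=\arg\min_{x\in\mathcal X}\{\Theta(x)-\langle\xi_0,x\rangle\}$, and for $n\ge0$ $$\xi_{n+1}=\xi_n-t_nA^*(\alpha_nI+AA^* )^{-1}(Ax_n-y),\qquad x_{n+1}=\arg\min_{x\in\mathcal X}\{\Theta(x)-\langle\xi_{n+1},x\rangle\},$$ $$t_n=\min\left\{\frac{\mu_0\langle(\alpha_nI+AA^* )^{-1}(Ax_n-y),Ax_n-y\rangle}{\|A^*(\alpha_nI+AA^* )^{-1}(Ax_n-y)\|^2},\ \mu_1\right\},$$ where the quotient is read as $+\infty$ (so $t_n=\mu_1$) if its denominator vanishes. One has $\xi_n\in\partial\Theta(x_n)$ for all $n$. $x^\dagger$ denotes the unique solution of $Ax=y$ in $\mathscr D(\Theta)$ satisfying $D_{\xi_0}\Theta(x^\dagger,x_0)=\min\{D_{\xi_0}\Theta(x,x_0):Ax=y\}$. *)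

theory Defs
  imports "HOL-Analysis.Analysis"
begin

text \<open>
  A real Hilbert space is a type of sort \<open>{real_inner, banach}\<close>. Functionals with values in
  $(-\infty,\infty]$ are \<open>ereal\<close>-valued; the exclusion of the value \<open>-\<infinity>\<close> is an explicit hypothesis
  where they are used.
\<close>

definition effective_domain :: "('a \<Rightarrow> ereal) \<Rightarrow> 'a set" where
  "effective_domain \<Theta> = {x. \<Theta> x < \<infinity>}"

definition proper_functional :: "('a \<Rightarrow> ereal) \<Rightarrow> bool" where
  "proper_functional \<Theta> \<longleftrightarrow> effective_domain \<Theta> \<noteq> {}"

definition lower_semicontinuous :: "('a::topological_space \<Rightarrow> ereal) \<Rightarrow> bool" where
  "lower_semicontinuous \<Theta> \<longleftrightarrow> (\<forall>x. \<Theta> x \<le> Liminf (at x) \<Theta>)"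

text \<open>At \<open>s = 0\<close> and \<open>s = 1\<close> the convention \<open>0 * \<infinity> = 0\<close> of \<open>ereal\<close> makes the inequality trivial.\<close>

definition strongly_convex :: "real \<Rightarrow> ('a::real_normed_vector \<Rightarrow> ereal) \<Rightarrow> bool" where
  "strongly_convex c \<Theta> \<longleftrightarrow>
     (\<forall>s x' x. 0 \<le> s \<and> s \<le> 1 \<longrightarrow>
        \<Theta> (s *\<^sub>R x' + (1 - s) *\<^sub>R x) + ereal (c * s * (1 - s) * (norm (x' - x))\<^sup>2)
          \<le> ereal s * \<Theta> x' + ereal (1 - s) * \<Theta> x)"

text \<open>
  \<open>bregman \<Theta> \<xi> x' x\<close> is $D_\xi\Theta(x',x)$. It is meaningful only if \<open>\<xi>\<close> is a subgradient of
  \<open>\<Theta>\<close> at \<open>x\<close> (so that \<open>\<Theta> x\<close> is finite), e.g. if \<open>x\<close> minimizes \<open>\<Theta> - \<langle>\<xi>, \<cdot>\<rangle>\<close>.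
\<close>

definition bregman :: "('a::real_inner \<Rightarrow> ereal) \<Rightarrow> 'a \<Rightarrow> 'a \<Rightarrow> 'a \<Rightarrow> ereal" where
  "bregman \<Theta> \<xi> x' x = \<Theta> x' - \<Theta> x - ereal (\<xi> \<bullet> (x' - x))"

definition primal_min :: "('a::real_inner \<Rightarrow> ereal) \<Rightarrow> 'a \<Rightarrow> 'a" where
  "primal_min \<Theta> \<xi> = arg_min (\<lambda>x. \<Theta> x - ereal (\<xi> \<bullet> x)) (\<lambda>_. True)"

text \<open>$(\alpha I + AA^*)^{-1}$; for \<open>\<alpha> > 0\<close> the operator being inverted is a bijection.\<close>

definition reg_inverse ::
    "('a::{real_inner, banach} \<Rightarrow>\<^sub>L 'b::{real_inner, banach}) \<Rightarrow> real \<Rightarrow> 'b \<Rightarrow> 'b" where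
  "reg_inverse A \<alpha> = inv (\<lambda>v. \<alpha> *\<^sub>R v + A (adjoint A v))"

text \<open>The step size as a function of the residual \<open>r = A x - y\<close>. The quotient counts as \<open>+\<infinity>\<close> if
  its denominator vanishes, in contrast to HOL's \<open>a / 0 = 0\<close>.\<close>

definition step_size ::
    "('a::{real_inner, banach} \<Rightarrow>\<^sub>L 'b::{real_inner, banach}) \<Rightarrow> real \<Rightarrow> real \<Rightarrow> real \<Rightarrow> 'b \<Rightarrow> real" where
  "step_size A \<mu>0 \<mu>1 \<alpha> r =
     (if (norm (adjoint A (reg_inverse A \<alpha> r)))\<^sup>2 = 0 then \<mu>1
      else min (\<mu>0 * (reg_inverse A \<alpha> r \<bullet> r) / (norm (adjoint A (reg_inverse A \<alpha> r)))\<^sup>2) \<mu>1)"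

definition bregman_solution ::
    "('a::{real_inner, banach} \<Rightarrow>\<^sub>L 'b::{real_inner, banach}) \<Rightarrow> 'b \<Rightarrow> ('a \<Rightarrow> ereal) \<Rightarrow> 'a \<Rightarrow> 'a \<Rightarrow> 'a" where
  "bregman_solution A y \<Theta> \<xi>0 x0 =
     (THE x. x \<in> effective_domain \<Theta> \<and> is_arg_min (\<lambda>z. bregman \<Theta> \<xi>0 z x0) (\<lambda>z. A z = y) x)"

end

theory Submission
  imports Defs
begin

text \<open>
  Write \<open>r n = A (x n) - y\<close> for the residual, \<open>v n\<close> for $(\alpha_n I + AA^*)^{-1} r_n$, and measure
  the residual by the energy $p_n = \langle v_n, r_n\rangle = \alpha_n\|v_n\|^2 + \|A^*v_n\|^2$.
  The update \<open>\<xi> (Suc n) = \<xi> n - t n *\<^sub>R adjoint A (v n)\<close> is a gradient step for the dual problem, and the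
  whole argument is carried by the Bregman distances \<open>B n z\<close> from \<open>x n\<close> to a solution \<open>z\<close>.

  One step lowers \<open>B n z\<close> by at least a fixed multiple of \<open>p n\<close> (\<open>B_descent\<close>): strong
  convexity supplies a term $c_0\|x_{n+1}-x_n\|^2$, which absorbs the cross term exactly because the
  step size obeys \<open>t n * (norm (adjoint A (v n)))\<^sup>2 \<le> \<mu>0 * p n\<close> with \<open>\<mu>0 < 4 * c0\<close>. Hence \<open>p\<close> is
  summable, and since \<open>p n\<close> dominates \<open>(norm (r n))\<^sup>2\<close> uniformly in \<open>n\<close>, the residual tends to \<open>0\<close>.

  To see that the iterates themselves converge, compare \<open>x k\<close> with a later \<open>x m\<close>. The three-point
  identity \<open>B_iterates\<close> reduces \<open>B k (x m)\<close> to \<open>B k z - B m z\<close> plus the products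
  $t_i\langle v_i, r_m\rangle$ for $k \le i < m$. As \<open>\<alpha>\<close> decreases, such a product is at most
  \<open>(p i + p m) / 2\<close> up to the factor \<open>t i\<close> (\<open>cross_term\<close>), which is a summable bound whenever \<open>p m\<close> is
  controlled by all the earlier \<open>p i\<close>, up to a summable perturbation \<open>q\<close> of \<open>p\<close>. Indices \<open>m\<close> with this property (\<open>record_index\<close>) occur
  arbitrarily late because \<open>p\<close> tends to \<open>0\<close>. For these, \<open>B k (x m)\<close> is bounded by the decrease from \<open>k\<close> to \<open>m\<close>
  of a convergent sequence \<open>E z\<close>, so the whole sequence \<open>x\<close> is Cauchy; by lower
  semicontinuity its limit \<open>u\<close> is a solution in the domain, and \<open>B k u\<close> tends to \<open>0\<close>.

  Finally, \<open>\<xi> k - \<xi> 0\<close> lies in the range of the adjoint and so is orthogonal to differences of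
  solutions. Therefore \<open>B k z - B k u\<close> does not depend on \<open>k\<close>; for the solution \<open>z\<close> minimising
  \<open>B 0\<close> it is nonpositive, so \<open>B k z\<close> tends to \<open>0\<close> as well, and strong convexity turns this
  into convergence in norm.

  Everything the iteration presupposes comes from one fact: a strongly convex function with closed
  sublevel sets on a Banach space has a minimiser (\<open>strongly_convex_on_minimiser\<close>). Applied to
  quadratic functions it yields the adjoint of \<open>A\<close> and the solvability of
  $(\alpha I + AA^*)v = r$; applied to \<open>\<Theta>\<close> minus a linear functional it yields the primal iterates
  and the Bregman-minimal solution.
\<close>

section \<open>Minimisers of strongly convex functions\<close>

text \<open>
  The extended-real functional is handled through its finite values on its domain \<open>D\<close>. Lower
  semicontinuity then reads: for each \<open>b\<close>, \<open>{z \<in> D. f z \<le> b}\<close> is closed in the whole space.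
\<close>

definition strongly_convex_on :: "real \<Rightarrow> 'a::real_normed_vector set \<Rightarrow> ('a \<Rightarrow> real) \<Rightarrow> bool" where
  "strongly_convex_on c D f \<longleftrightarrow>
     (\<forall>s x' x. 0 \<le> s \<and> s \<le> 1 \<and> x' \<in> D \<and> x \<in> D \<longrightarrow>
        s *\<^sub>R x' + (1 - s) *\<^sub>R x \<in> D \<and>
        f (s *\<^sub>R x' + (1 - s) *\<^sub>R x) + c * s * (1 - s) * (norm (x' - x))\<^sup>2
          \<le> s * f x' + (1 - s) * f x)"

lemma strongly_convex_onD:
  assumes "strongly_convex_on c D f" "0 \<le> s" "s \<le> 1" "x' \<in> D" "x \<in> D"
  shows "s *\<^sub>R x' + (1 - s) *\<^sub>R x \<in> D"
    and "f (s *\<^sub>R x' + (1 - s) *\<^sub>R x) + c * s * (1 - s) * (norm (x' - x))\<^sup>2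
          \<le> s * f x' + (1 - s) * f x"
  using assms unfolding strongly_convex_on_def by blast+

text \<open>
  Closedness of one sublevel set bounds \<open>f\<close> below on a ball around \<open>a\<close>. A far point \<open>z\<close> is pulled
  into that ball along the segment to \<open>a\<close>; strong convexity then bounds \<open>f z\<close> below by a quadratic in
  the distance with positive leading coefficient. This replaces the usual appeal to an affine
  minorant, hence to the Hahn--Banach theorem.
\<close>

lemma strongly_convex_on_bounded_below:
  fixes f :: "'a::real_normed_vector \<Rightarrow> real"
  assumes c: "c > 0" and sc: "strongly_convex_on c D f" and a: "a \<in> D"
    and cl: "\<And>b. closed {z \<in> D. f z \<le> b}"
  shows "\<exists>b. \<forall>z\<in>D. b \<le> f z"
proof -
  have "open (- {z \<in> D. f z \<le> f a - 1})" "a \<in> - {z \<in> D. f z \<le> f a - 1}"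
    using cl by auto
  then obtain r where r: "r > 0" "ball a r \<subseteq> - {z \<in> D. f z \<le> f a - 1}"
    using openE by blast
  have near: "f a - 1 \<le> f z" if "z \<in> D" "norm (z - a) < r" for z
    using r(2) that by (force simp: dist_norm norm_minus_commute)
  have "f a - 1 - 2 / (c * r\<^sup>2) \<le> f z" if z: "z \<in> D" for z
  proof (cases "norm (z - a) < r")
    case True
    have "2 / (c * r\<^sup>2) \<ge> 0" using c by simp
    then show ?thesis using near[OF z True] by linarith
  next
    case False
    define d where "d = norm (z - a)"
    \<comment> \<open>puts the pulled-in point at distance \<open>r / 2\<close> from \<open>a\<close>\<close>
    define s where "s = r / (2 * d)"
    have d: "d \<ge> r" "d > 0" using False r(1) by (auto simp: d_def)
    have s: "0 < s" "s \<le> 1/2" using d r(1) by (auto simp: s_def field_simps)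
    have "norm (s *\<^sub>R z + (1 - s) *\<^sub>R a - a) = norm (s *\<^sub>R (z - a))"
      by (simp add: algebra_simps)
    also have "\<dots> = r / 2" using s d r(1) by (simp add: d_def[symmetric] s_def)
    finally have "f a - 1 \<le> f (s *\<^sub>R z + (1 - s) *\<^sub>R a)"
      using near strongly_convex_onD(1)[OF sc, of s z a] s z a r(1) by simp
    then have "f a - 1 + c * s * (1 - s) * d\<^sup>2 \<le> s * f z + (1 - s) * f a"
      using strongly_convex_onD(2)[OF sc, of s z a] s z a unfolding d_def by simp
    then have "s * (f a - f z + c * (1 - s) * d\<^sup>2) \<le> s * (1 / s)"
      using s by (simp add: algebra_simps)
    then have "f a - f z + c * (1 - s) * d\<^sup>2 \<le> 1 / s"
      using s(1) by (simp only: mult_le_cancel_left_pos)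
    moreover have "c * (1/2) * d\<^sup>2 \<le> c * (1 - s) * d\<^sup>2"
      using s c by (intro mult_mono) auto
    moreover have "1 / s = 2 * d / r" by (simp add: s_def)
    \<comment> \<open>the maximum of the left-hand side over \<open>d\<close>, attained at \<open>d = 2 / (c * r)\<close>\<close>
    moreover have "2 * d / r - c * (1/2) * d\<^sup>2 \<le> 2 / (c * r\<^sup>2)"
    proof -
      have "0 \<le> (c / 2) * (d - 2 / (c * r))\<^sup>2" using c by simp
      also have "\<dots> = c * (1/2) * d\<^sup>2 - 2 * d / r + 2 / (c * r\<^sup>2)"
        using c r(1) by (simp add: field_simps power2_eq_square)
      finally show ?thesis by simp
    qed
    ultimately show ?thesis by simp
  qed
  then show ?thesis by blast
qed

text \<open>
  Compare \<open>m\<close> with the points of the segment towards \<open>z\<close>, divide by the parameter \<open>s\<close> and let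
  \<open>s\<close> tend to \<open>0\<close>.
\<close>

lemma strongly_convex_on_growth:
  assumes sc: "strongly_convex_on c D f" and m: "m \<in> D" "\<And>z. z \<in> D \<Longrightarrow> f m \<le> f z" and z: "z \<in> D"
  shows "f m + c * (norm (z - m))\<^sup>2 \<le> f z"
proof -
  have *: "f m + c * (1 - s) * (norm (z - m))\<^sup>2 \<le> f z" if s: "0 < s" "s < 1" for s
  proof -
    have "f m + c * s * (1 - s) * (norm (z - m))\<^sup>2 \<le> s * f z + (1 - s) * f m"
      using strongly_convex_onD[OF sc, of s z m] m z s
        m(2)[of "s *\<^sub>R z + (1 - s) *\<^sub>R m"] by force
    then have "s * (f m + c * (1 - s) * (norm (z - m))\<^sup>2) \<le> s * f z"
      by (simp add: algebra_simps)
    then show ?thesis using s(1) by (simp only: mult_le_cancel_left_pos)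
  qed
  have "((\<lambda>s. f m + c * (1 - s) * (norm (z - m))\<^sup>2) \<longlongrightarrow> f m + c * (1 - 0) * (norm (z - m))\<^sup>2)
      (at_right 0)"
    by (intro tendsto_intros)
  moreover have "eventually (\<lambda>s. f m + c * (1 - s) * (norm (z - m))\<^sup>2 \<le> f z) (at_right (0::real))"
    unfolding eventually_at_right_field using * by (intro exI[of _ 1]) auto
  ultimately show ?thesis
    using tendsto_upperbound[OF _ _ trivial_limit_at_right_real] by fastforce
qed

text \<open>
  Strong convexity at midpoints makes every minimising sequence a Cauchy sequence, and closed sublevel
  sets carry the infimum over to its limit.
\<close>

lemma strongly_convex_on_minimiser:
  fixes f :: "'a::banach \<Rightarrow> real"
  assumes c: "c > 0" and sc: "strongly_convex_on c D f" and ne: "D \<noteq> {}"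
    and cl: "\<And>b. closed {z \<in> D. f z \<le> b}"
  obtains m where "m \<in> D" "\<And>z. z \<in> D \<Longrightarrow> f m \<le> f z"
proof -
  define I where "I = (INF z\<in>D. f z)"
  obtain b where b: "\<forall>z\<in>D. b \<le> f z"
    using strongly_convex_on_bounded_below[OF c sc _ cl] ne by blast
  then have bdd: "bdd_below (f ` D)" by auto
  have I: "I \<le> f z" if "z \<in> D" for z
    unfolding I_def using bdd that by (rule cINF_lower)
  have "\<exists>z\<in>D. f z < I + inverse (real (Suc n))" for n
    using cINF_less_iff[OF ne bdd, of "I + inverse (real (Suc n))"] unfolding I_def by simp
  then obtain u where u: "\<And>n. u n \<in> D" "\<And>n. f (u n) < I + inverse (real (Suc n))"
    by metis
  have close: "c * (norm (u i - u j))\<^sup>2 \<le> 4 * inverse (real (Suc N))" if "i \<ge> N" "j \<ge> N" for i j N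
  proof -
    have "inverse (real (Suc i)) \<le> inverse (real (Suc N))"
      "inverse (real (Suc j)) \<le> inverse (real (Suc N))"
      using that by (auto intro!: le_imp_inverse_le)
    moreover have "I + c * (1/2) * (1 - 1/2) * (norm (u i - u j))\<^sup>2
        \<le> (1/2) * f (u i) + (1 - 1/2) * f (u j)"
      using strongly_convex_onD[OF sc, of "1/2" "u i" "u j"] u(1)
        I[of "(1/2) *\<^sub>R u i + (1 - 1/2) *\<^sub>R u j"] by force
    then have "I + c * (norm (u i - u j))\<^sup>2 / 4 \<le> f (u i) / 2 + f (u j) / 2"
      by simp
    ultimately show ?thesis using u(2)[of i] u(2)[of j] by linarith
  qed
  have "Cauchy u"
  proof (rule CauchyI)
    fix e :: real assume e: "e > 0"
    then have "c * e\<^sup>2 / 4 > 0" using c by simp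
    then obtain N where N: "inverse (real (Suc N)) < c * e\<^sup>2 / 4"
      using reals_Archimedean by blast
    have "norm (u i - u j) < e" if "i \<ge> N" "j \<ge> N" for i j
    proof -
      have "c * (norm (u i - u j))\<^sup>2 < c * e\<^sup>2" using close[OF that] N by linarith
      then show ?thesis using c e power_less_imp_less_base[of "norm (u i - u j)" 2 e] by simp
    qed
    then show "\<exists>M. \<forall>m\<ge>M. \<forall>n\<ge>M. norm (u m - u n) < e" by blast
  qed
  then obtain m where m: "u \<longlonglongrightarrow> m" using Cauchy_convergent convergent_def by blast
  have level: "m \<in> {z \<in> D. f z \<le> I + e}" if e: "e > 0" for e
  proof -
    obtain N where N: "inverse (real (Suc N)) < e" using reals_Archimedean[OF e] by blast
    have "f (u n) \<le> I + e" if n: "n \<ge> N" for n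
    proof -
      have "inverse (real (Suc n)) \<le> inverse (real (Suc N))"
        using n by (auto intro!: le_imp_inverse_le)
      then show ?thesis using u(2)[of n] N by linarith
    qed
    then have "\<forall>\<^sub>F n in sequentially. u n \<in> {z \<in> D. f z \<le> I + e}"
      using u(1) by (intro eventually_sequentiallyI[of N]) simp
    then show ?thesis
      using Lim_in_closed_set[OF cl[of "I + e"] _ sequentially_bot m] by blast
  qed
  have "m \<in> D" using level[of 1] by simp
  moreover have "f m \<le> f z" if "z \<in> D" for z
  proof -
    have "f m \<le> I"
    proof (rule field_le_epsilon)
      show "f m \<le> I + e" if "e > 0" for e using level[OF that] by simp
    qed
    then show ?thesis using I[OF that] by linarith
  qed
  ultimately show ?thesis using that by blast
qed

lemma closed_sublevel_add_continuous:
  fixes f g :: "'a::metric_space \<Rightarrow> real"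
  assumes cl: "\<And>b. closed {z \<in> D. f z \<le> b}" and g: "continuous_on UNIV g"
  shows "closed {z \<in> D. f z + g z \<le> b}"
  unfolding closed_sequential_limits
proof (intro allI impI)
  fix u z assume *: "(\<forall>n. u n \<in> {z \<in> D. f z + g z \<le> b}) \<and> u \<longlonglongrightarrow> z"
  then have "(\<lambda>n. g (u n)) \<longlonglongrightarrow> g z"
    using g continuous_on_tendsto_compose[OF g, of u z sequentially] by simp
  then have near: "\<forall>\<^sub>F n in sequentially. g z - e < g (u n)" if "e > 0" for e
    using that by (intro order_tendstoD(1)) auto
  have "\<forall>\<^sub>F n in sequentially. u n \<in> {z' \<in> D. f z' \<le> b - g z + e}" if "e > 0" for e
  proof (rule eventually_mono[OF near[OF that]])
    fix n assume "g z - e < g (u n)"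
    moreover have "u n \<in> D" "f (u n) + g (u n) \<le> b" using * by auto
    ultimately show "u n \<in> {z' \<in> D. f z' \<le> b - g z + e}" by simp
  qed
  then have level: "z \<in> {z' \<in> D. f z' \<le> b - g z + e}" if "e > 0" for e
    using Lim_in_closed_set[OF cl _ sequentially_bot] * that by blast
  have "f z \<le> b - g z"
  proof (rule field_le_epsilon)
    show "f z \<le> b - g z + e" if "e > 0" for e using level[OF that] by simp
  qed
  then show "z \<in> {z \<in> D. f z + g z \<le> b}" using level[of 1] by simp
qed

section \<open>The adjoint and the regularised inverse\<close>

text \<open>
  The solution is the minimiser of the strongly convex quadratic \<open>b v v / 2 - l v\<close>. With the inner product as \<open>b\<close>
  this is the Riesz representation theorem; with \<open>\<alpha> * (v \<bullet> w) + adjoint A v \<bullet> adjoint A w\<close> it inverts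
  $\alpha I + AA^*$.
\<close>

lemma symmetric_Lax_Milgram:
  fixes b :: "'a::{real_inner, banach} \<Rightarrow> 'a \<Rightarrow> real"
  assumes bb: "bounded_bilinear b" and sym: "\<And>v w. b v w = b w v"
    and k: "k > 0" and coercive: "\<And>v. k * (norm v)\<^sup>2 \<le> b v v" and l: "bounded_linear l"
  obtains u where "\<And>w. b u w = l w"
proof -
  interpret b: bounded_bilinear b by fact
  interpret l: bounded_linear l by fact
  define q where "q v = b v v / 2 - l v" for v
  have "strongly_convex_on (k / 2) UNIV q"
    unfolding strongly_convex_on_def
  proof (intro allI impI conjI)
    fix s :: real and v w :: 'a
    assume s: "0 \<le> s \<and> s \<le> 1 \<and> v \<in> UNIV \<and> w \<in> UNIV"
    have "s * (1 - s) * (k * (norm (v - w))\<^sup>2) \<le> s * (1 - s) * b (v - w) (v - w)"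
      using s coercive by (intro mult_left_mono) auto
    moreover have "q (s *\<^sub>R v + (1 - s) *\<^sub>R w) =
        s * q v + (1 - s) * q w - s * (1 - s) * b (v - w) (v - w) / 2"
      using sym[of w v]
      by (simp add: q_def b.add_left b.add_right b.diff_left b.diff_right b.scaleR_left
          b.scaleR_right l.add l.scaleR) (simp add: field_simps)
    ultimately show "q (s *\<^sub>R v + (1 - s) *\<^sub>R w) + k / 2 * s * (1 - s) * (norm (v - w))\<^sup>2
        \<le> s * q v + (1 - s) * q w"
      by (simp add: field_simps)
  qed simp
  moreover have "continuous_on UNIV q"
    unfolding q_def
    by (intro continuous_intros b.continuous_on l.continuous_on) simp
  then have "closed {z \<in> UNIV. q z \<le> a}" for a
    using closed_Collect_le[of q "\<lambda>_. a"] by (simp add: continuous_on_const)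
  ultimately obtain u where u: "\<And>z. q u \<le> q z"
    using strongly_convex_on_minimiser[of "k / 2" UNIV q] k by auto
  have "b u w = l w" for w
  proof (rule ccontr)
    assume ne: "b u w \<noteq> l w"
    define g where "g = b u w - l w"
    define B where "B = b w w"
    have w: "w \<noteq> 0" using ne by (auto simp: b.zero_right l.zero)
    have B: "B > 0" using coercive[of w] k w unfolding B_def
      by (smt (verit) mult_pos_pos zero_less_norm_iff zero_less_power)
    \<comment> \<open>the step along \<open>w\<close> that minimises the parabola \<open>s \<mapsto> q (u + s w)\<close>\<close>
    have "q (u + (- g / B) *\<^sub>R w) = q u - g\<^sup>2 / (2 * B)"
      using sym[of w u] B unfolding q_def g_def B_def
      by (simp add: b.add_left b.add_right b.scaleR_left b.scaleR_right l.add l.scaleR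
          del: scaleR_minus_left)
        (simp add: field_simps power2_eq_square)
    moreover have "g\<^sup>2 / (2 * B) > 0" using ne B by (simp add: g_def)
    ultimately show False using u[of "u + (- g / B) *\<^sub>R w"] by linarith
  qed
  then show ?thesis using that by blast
qed

text \<open>
  The constant \<open>adjoint\<close> is a choice of some adjoint map; on Hilbert spaces one exists by the Riesz
  representation of \<open>\<lambda>z. A z \<bullet> v\<close>.
\<close>

lemma inner_adjoint_blinfun:
  fixes A :: "'a::{real_inner, banach} \<Rightarrow>\<^sub>L 'b::real_inner"
  shows "A z \<bullet> v = z \<bullet> adjoint A v"
proof -
  have "\<exists>u. \<forall>z. A z \<bullet> v = z \<bullet> u" for v
  proof -
    have "bounded_linear (\<lambda>z. A z \<bullet> v)"
      by (intro bounded_linear_inner_left_comp blinfun.bounded_linear_right)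
    then obtain u where "\<And>z. u \<bullet> z = A z \<bullet> v"
      using symmetric_Lax_Milgram[OF bounded_bilinear_inner, of 1 "\<lambda>z. A z \<bullet> v"]
      by (auto simp: inner_commute power2_norm_eq_inner)
    then show ?thesis by (metis inner_commute)
  qed
  then have "\<exists>f. \<forall>z v. A z \<bullet> v = z \<bullet> f v" by metis
  then show ?thesis unfolding adjoint_def
    by (rule someI2_ex) blast
qed

lemma bounded_linear_adjoint_blinfun:
  fixes A :: "'a::{real_inner, banach} \<Rightarrow>\<^sub>L 'b::real_inner"
  shows "bounded_linear (adjoint A)"
proof (rule bounded_linear_intro)
  show "adjoint A (v + w) = adjoint A v + adjoint A w" for v w
    by (rule vector_eq_ldot[THEN iffD1])
      (simp add: inner_add_right inner_adjoint_blinfun[symmetric])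
  show "adjoint A (s *\<^sub>R v) = s *\<^sub>R adjoint A v" for s v
    by (rule vector_eq_ldot[THEN iffD1])
      (simp add: inner_adjoint_blinfun[symmetric])
  show "norm (adjoint A v) \<le> norm v * norm A" for v
  proof -
    have "(norm (adjoint A v))\<^sup>2 = A (adjoint A v) \<bullet> v"
      by (simp add: inner_adjoint_blinfun power2_norm_eq_inner)
    also have "\<dots> \<le> norm (A (adjoint A v)) * norm v" by (rule norm_cauchy_schwarz)
    also have "\<dots> \<le> norm A * norm (adjoint A v) * norm v"
      by (intro mult_right_mono norm_blinfun) auto
    finally have "norm (adjoint A v) * norm (adjoint A v) \<le> norm (adjoint A v) * (norm v * norm A)"
      by (simp add: power2_eq_square algebra_simps)
    then show ?thesis
      by (cases "adjoint A v = 0") (simp_all add: mult_le_cancel_left_pos)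
  qed
qed

lemma reg_inverse_eq:
  fixes A :: "'a::{real_inner, banach} \<Rightarrow>\<^sub>L 'b::{real_inner, banach}"
  assumes a: "\<alpha> > 0"
  shows "\<alpha> *\<^sub>R reg_inverse A \<alpha> r + A (adjoint A (reg_inverse A \<alpha> r)) = r"
proof -
  interpret adj: bounded_linear "adjoint A" by (rule bounded_linear_adjoint_blinfun)
  have "surj (\<lambda>v. \<alpha> *\<^sub>R v + A (adjoint A v))"
    unfolding surj_def
  proof
    fix r
    define b where "b v w = \<alpha> * (v \<bullet> w) + adjoint A v \<bullet> adjoint A w" for v w
    have "bounded_bilinear b"
    proof
      obtain K where K: "K \<ge> 0" "\<And>v. norm (adjoint A v) \<le> norm v * K"
        using adj.nonneg_bounded by blast
      have "norm (b v w) \<le> norm v * norm w * (\<alpha> + K * K)" for v w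
      proof -
        have "\<bar>b v w\<bar> \<le> \<alpha> * \<bar>v \<bullet> w\<bar> + \<bar>adjoint A v \<bullet> adjoint A w\<bar>"
          unfolding b_def using a by (metis abs_mult abs_of_pos abs_triangle_ineq)
        also have "\<dots> \<le> \<alpha> * (norm v * norm w) + norm (adjoint A v) * norm (adjoint A w)"
          using a by (intro add_mono mult_left_mono Cauchy_Schwarz_ineq2) auto
        also have "\<dots> \<le> \<alpha> * (norm v * norm w) + (norm v * K) * (norm w * K)"
          using K by (intro add_left_mono mult_mono) auto
        finally show ?thesis by (simp add: algebra_simps)
      qed
      then show "\<exists>K. \<forall>v w. norm (b v w) \<le> norm v * norm w * K" by blast
    qed (simp_all add: b_def adj.add adj.scaleR inner_add_left inner_add_right algebra_simps)
    moreover have "\<alpha> * (norm v)\<^sup>2 \<le> b v v" for v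
      by (simp add: b_def power2_norm_eq_inner)
    ultimately obtain v where "\<And>w. b v w = r \<bullet> w"
      using symmetric_Lax_Milgram[of b \<alpha> "\<lambda>w. r \<bullet> w"] a
      by (auto simp: b_def inner_commute intro: bounded_linear_inner_right)
    then have "w \<bullet> (\<alpha> *\<^sub>R v + A (adjoint A v)) = w \<bullet> r" for w
      by (simp add: b_def inner_add_right inner_commute[of w] inner_adjoint_blinfun)
    then have "\<alpha> *\<^sub>R v + A (adjoint A v) = r"
      by (subst vector_eq_ldot[symmetric]) blast
    then show "\<exists>v. r = \<alpha> *\<^sub>R v + A (adjoint A v)" by metis
  qed
  from surj_f_inv_f[OF this, of r] show ?thesis unfolding reg_inverse_def .
qed

section \<open>The iteration with a finite-valued functional\<close>

text \<open>
  The minimising property of \<open>x n\<close> enters as the subgradient inequality for \<open>\<xi> n\<close>, sharpened by the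
  quadratic term of strong convexity (\<open>growth\<close>), and the step-size rule enters through the three bounds on
  \<open>t\<close>.
\<close>

locale dual_gradient_iteration =
  fixes A :: "'a::{real_inner, banach} \<Rightarrow>\<^sub>L 'b::{real_inner, banach}"
    and y :: 'b and D :: "'a set" and f :: "'a \<Rightarrow> real"
    and c0 \<mu>0 \<mu>1 \<tau> :: real and \<alpha> t :: "nat \<Rightarrow> real"
    and \<xi> x :: "nat \<Rightarrow> 'a" and v :: "nat \<Rightarrow> 'b"
  assumes c0: "c0 > 0"
    and closed_sublevel: "\<And>b. closed {z \<in> D. f z \<le> b}"
    and x_in: "\<And>n. x n \<in> D"
    and growth: "\<And>n z. z \<in> D \<Longrightarrow> f (x n) + \<xi> n \<bullet> (z - x n) + c0 * (norm (z - x n))\<^sup>2 \<le> f z"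
    and decseq: "decseq \<alpha>" and \<alpha>_pos: "\<And>n. \<alpha> n > 0"
    and v_eq: "\<And>n. \<alpha> n *\<^sub>R v n + A (adjoint A (v n)) = A (x n) - y"
    and step: "\<And>n. \<xi> (Suc n) = \<xi> n - t n *\<^sub>R adjoint A (v n)"
    and \<tau>: "\<tau> > 0" and t_lower: "\<And>n. \<tau> \<le> t n" and t_upper: "\<And>n. t n \<le> \<mu>1"
    and t_bound: "\<And>n. t n * (norm (adjoint A (v n)))\<^sup>2 \<le> \<mu>0 * (v n \<bullet> (A (x n) - y))"
    and \<mu>0: "\<mu>0 < 4 * c0"
begin

text \<open>
  \<open>B n z\<close> is the Bregman distance of \<open>z\<close> from \<open>x n\<close> with respect to the subgradient \<open>\<xi> n\<close>.
\<close>

definition B :: "nat \<Rightarrow> 'a \<Rightarrow> real" where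
  "B n z = f z - f (x n) - \<xi> n \<bullet> (z - x n)"

definition p :: "nat \<Rightarrow> real" where
  "p n = v n \<bullet> (A (x n) - y)"

lemma B_growth: "z \<in> D \<Longrightarrow> c0 * (norm (z - x n))\<^sup>2 \<le> B n z"
  using growth[of z n] by (simp add: B_def)

lemma B_nonneg: "z \<in> D \<Longrightarrow> 0 \<le> B n z"
  using B_growth[of z n] c0 by (smt (verit) mult_nonneg_nonneg zero_le_power2)

lemma inner_v: "w \<bullet> (A (x n) - y) = \<alpha> n * (w \<bullet> v n) + adjoint A w \<bullet> adjoint A (v n)"
  unfolding v_eq[symmetric]
  by (simp add: inner_add_right inner_commute[of w] inner_adjoint_blinfun)
    (simp add: inner_commute)

lemma p_eq: "p n = \<alpha> n * (norm (v n))\<^sup>2 + (norm (adjoint A (v n)))\<^sup>2"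
  by (simp add: p_def inner_v power2_norm_eq_inner)

lemma p_nonneg: "0 \<le> p n"
  using \<alpha>_pos[of n] by (simp add: p_eq)

text \<open>
  The constant must not degenerate when \<open>\<alpha> n\<close> tends to \<open>0\<close>, so the two summands of
  \<open>\<alpha> n *\<^sub>R v n + A (adjoint A (v n))\<close> are paired with the residual separately and the second one is
  absorbed by Young's inequality.
\<close>

lemma residual_le: "(norm (A (x n) - y))\<^sup>2 \<le> (2 * \<alpha> 0 + (norm A)\<^sup>2) * p n"
proof -
  let ?r = "A (x n) - y" and ?g = "adjoint A (v n)"
  have "\<alpha> n \<le> \<alpha> 0" using decseq by (simp add: decseq_def)
  then have 1: "\<alpha> n * p n \<le> \<alpha> 0 * p n" using p_nonneg by (rule mult_right_mono)
  have 2: "(norm ?g)\<^sup>2 \<le> p n"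
    using \<alpha>_pos[of n] by (simp add: p_eq)
  have "(norm ?r)\<^sup>2 = (\<alpha> n *\<^sub>R v n + A ?g) \<bullet> ?r"
    by (simp only: v_eq power2_norm_eq_inner)
  also have "\<dots> = \<alpha> n * p n + A ?g \<bullet> ?r"
    by (simp add: inner_add_left p_def)
  also have "A ?g \<bullet> ?r \<le> norm A * norm ?g * norm ?r"
    using norm_cauchy_schwarz[of "A ?g" ?r] norm_blinfun[of A ?g]
    by (meson mult_right_mono norm_ge_zero order_trans)
  also have "\<dots> \<le> (norm A)\<^sup>2 * (norm ?g)\<^sup>2 / 2 + (norm ?r)\<^sup>2 / 2"
    using sum_squares_bound[of "norm A * norm ?g" "norm ?r"] by (simp add: power_mult_distrib)
  also have "(norm A)\<^sup>2 * (norm ?g)\<^sup>2 \<le> (norm A)\<^sup>2 * p n"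
    using 2 by (rule mult_left_mono) simp
  finally show ?thesis using 1 by (simp add: algebra_simps)
qed

text \<open>
  With $g = A^*v_n$ and $d = x_n - x_{n+1}$ one has exactly
  $B_{n+1}(z) = B_n(z) - B_n(x_{n+1}) + t_n\langle g, d\rangle - t_n p_n$, and Young's inequality
  splits the inner product into $c_0\|d\|^2$, compensated by $B_n(x_{n+1})$, and a part of
  $t_n p_n$ that is smaller than $t_n p_n$ because \<open>\<mu>0 < 4 * c0\<close>.
\<close>

lemma B_descent:
  assumes z: "A z = y"
  shows "B (Suc n) z \<le> B n z - (1 - \<mu>0 / (4 * c0)) * \<tau> * p n"
proof -
  define g where "g = adjoint A (v n)"
  define d where "d = x n - x (Suc n)"
  have gz: "g \<bullet> (z - x n) = - p n"
    by (simp add: g_def inner_commute[of "adjoint A (v n)"] inner_adjoint_blinfun[symmetric]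
        p_def blinfun.diff_right z inner_commute[of "v n"] inner_diff_left)
  have "0 \<le> (norm ((2 * c0) *\<^sub>R d - t n *\<^sub>R g))\<^sup>2" by simp
  also have "\<dots> = 4 * c0 * (c0 * (norm d)\<^sup>2 - t n * (g \<bullet> d)) + t n * (t n * (norm g)\<^sup>2)"
    by (simp add: power2_norm_eq_inner inner_diff_left inner_diff_right inner_commute[of d g]
        algebra_simps)
  also have "t n * (t n * (norm g)\<^sup>2) \<le> t n * (\<mu>0 * p n)"
    using t_bound[of n] t_lower[of n] \<tau> unfolding g_def p_def by (intro mult_left_mono) auto
  finally have young: "t n * (g \<bullet> d) \<le> c0 * (norm d)\<^sup>2 + \<mu>0 / (4 * c0) * (t n * p n)"
    using c0 by (simp add: field_simps)
  have "B (Suc n) z = B n z - B n (x (Suc n)) + t n * (g \<bullet> (z - x (Suc n)))"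
    by (simp add: B_def step g_def[symmetric] inner_diff_left inner_diff_right algebra_simps)
  also have "g \<bullet> (z - x (Suc n)) = g \<bullet> d - p n"
    using gz by (simp add: d_def inner_diff_right)
  finally have "B (Suc n) z = B n z - B n (x (Suc n)) + t n * (g \<bullet> d) - t n * p n"
    by (simp add: algebra_simps)
  moreover have "c0 * (norm d)\<^sup>2 \<le> B n (x (Suc n))"
    using B_growth[OF x_in, of "Suc n" n] by (simp add: d_def norm_minus_commute)
  ultimately have "B (Suc n) z \<le> B n z - (1 - \<mu>0 / (4 * c0)) * (t n * p n)"
    using young by (simp add: algebra_simps)
  moreover have "(1 - \<mu>0 / (4 * c0)) * (\<tau> * p n) \<le> (1 - \<mu>0 / (4 * c0)) * (t n * p n)"
    using \<mu>0 c0 t_lower[of n] p_nonneg[of n] by (intro mult_left_mono mult_right_mono) auto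
  ultimately show ?thesis by (simp only: mult.assoc)
qed

lemma summable_p:
  assumes z: "z \<in> D" "A z = y"
  shows "summable p"
proof -
  define k where "k = (1 - \<mu>0 / (4 * c0)) * \<tau>"
  have k: "k > 0" using \<mu>0 c0 \<tau> by (simp add: k_def)
  have "B n z + k * (\<Sum>i<n. p i) \<le> B 0 z" for n
  proof (induction n)
    case (Suc n)
    then show ?case using B_descent[OF z(2), of n] by (simp add: k_def algebra_simps)
  qed simp
  then have "(\<Sum>i<n. p i) \<le> B 0 z / k" for n
    using B_nonneg[OF z(1), of n] k by (simp add: field_simps) (smt (verit))
  then show ?thesis
    using p_nonneg by (intro summableI_nonneg_bounded[of p "B 0 z / k"]) auto
qed

lemma residual_tendsto_0:
  assumes "summable p"
  shows "(\<lambda>n. A (x n)) \<longlonglongrightarrow> y"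
proof -
  have "(\<lambda>n. (2 * \<alpha> 0 + (norm A)\<^sup>2) * p n) \<longlonglongrightarrow> (2 * \<alpha> 0 + (norm A)\<^sup>2) * 0"
    by (rule tendsto_mult[OF tendsto_const summable_LIMSEQ_zero[OF assms]])
  then have lim: "(\<lambda>n. (2 * \<alpha> 0 + (norm A)\<^sup>2) * p n) \<longlonglongrightarrow> 0" by simp
  have "(\<lambda>n. (norm (A (x n) - y))\<^sup>2) \<longlonglongrightarrow> 0"
    by (rule Lim_null_comparison[OF always_eventually[OF allI] lim]) (simp add: residual_le)
  from tendsto_real_sqrt[OF this] have "(\<lambda>n. norm (A (x n) - y)) \<longlonglongrightarrow> 0"
    by simp
  then show ?thesis using LIM_zero_iff tendsto_norm_zero_iff by blast
qed

text \<open>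
  Expanding the residual at \<open>m\<close> gives an inner product of \<open>v n\<close> and \<open>v m\<close> in the metric of
  $\alpha_m I + AA^*$. Monotonicity of \<open>\<alpha>\<close> lets the square of \<open>v n\<close> in that metric be bounded by its square
  in the metric with \<open>\<alpha> n\<close>, which is \<open>p n\<close>.
\<close>

lemma cross_term:
  assumes "n \<le> m"
  shows "\<bar>v n \<bullet> (A (x m) - y)\<bar> \<le> (p n + p m) / 2"
proof -
  have young: "\<bar>a \<bullet> b\<bar> \<le> ((norm a)\<^sup>2 + (norm b)\<^sup>2) / 2" for a b :: "'c::real_inner"
    using Cauchy_Schwarz_ineq2[of a b] sum_squares_bound[of "norm a" "norm b"] by simp
  have "\<bar>v n \<bullet> (A (x m) - y)\<bar> \<le> \<alpha> m * \<bar>v n \<bullet> v m\<bar> + \<bar>adjoint A (v n) \<bullet> adjoint A (v m)\<bar>"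
    unfolding inner_v using \<alpha>_pos[of m] by (metis abs_mult abs_of_pos abs_triangle_ineq)
  also have "\<dots> \<le> \<alpha> m * (((norm (v n))\<^sup>2 + (norm (v m))\<^sup>2) / 2)
      + ((norm (adjoint A (v n)))\<^sup>2 + (norm (adjoint A (v m)))\<^sup>2) / 2"
    using \<alpha>_pos[of m] by (intro add_mono mult_left_mono young) auto
  also have "\<dots> = (\<alpha> m * (norm (v n))\<^sup>2 + (norm (adjoint A (v n)))\<^sup>2 + p m) / 2"
    by (simp add: p_eq field_simps)
  also have "\<alpha> m * (norm (v n))\<^sup>2 \<le> \<alpha> n * (norm (v n))\<^sup>2"
    using decseq assms by (intro mult_right_mono) (auto simp: decseq_def)
  finally show ?thesis by (simp add: p_eq)
qed

lemma \<xi>_telescope: "k \<le> m \<Longrightarrow> \<xi> m - \<xi> k = - (\<Sum>i=k..<m. t i *\<^sub>R adjoint A (v i))"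
  by (induction m rule: dec_induct) (simp_all add: step algebra_simps)

lemma inner_\<xi>_diff:
  assumes "k \<le> m"
  shows "(\<xi> m - \<xi> k) \<bullet> w = - (\<Sum>i=k..<m. t i * (v i \<bullet> A w))"
  by (simp add: \<xi>_telescope[OF assms] inner_sum_left inner_commute[of "adjoint A _"]
      inner_adjoint_blinfun[symmetric] inner_commute[of "A w"])

lemma B_iterates:
  "B k (x m) = B k z - B m z + (\<xi> m - \<xi> k) \<bullet> (x m - z)"
  by (simp add: B_def inner_diff_left inner_diff_right algebra_simps)

text \<open>
  The summable perturbation keeps \<open>q\<close> positive even if some \<open>p n\<close> vanishes; a positive null sequence
  attains new minima arbitrarily late.
\<close>

definition q :: "nat \<Rightarrow> real" where
  "q n = p n + (1/2) ^ n"

lemma q_pos: "0 < q n"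
  using p_nonneg[of n] by (simp add: q_def add_nonneg_pos)

lemma summable_q: "summable p \<Longrightarrow> summable q"
  unfolding q_def by (intro summable_add summable_geometric) auto

definition record_index :: "nat \<Rightarrow> bool" where
  "record_index m \<longleftrightarrow> (\<forall>n\<le>m. q m \<le> q n)"

lemma record_index_exists:
  assumes "summable p"
  shows "\<exists>m\<ge>N. record_index m"
proof -
  define e where "e = Min (q ` {..N})"
  have e: "e > 0" using q_pos by (simp add: e_def)
  have "\<forall>\<^sub>F n in sequentially. q n < e"
    using summable_LIMSEQ_zero[OF summable_q[OF assms]] e by (intro order_tendstoD(2))
  then have ex: "\<exists>n. q n < e" using eventually_sequentially by auto
  \<comment> \<open>the first index at which \<open>q\<close> drops below all its values up to \<open>N\<close>\<close>
  define m where "m = (LEAST n. q n < e)"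
  have m: "q m < e" unfolding m_def using ex by (rule LeastI_ex)
  have "e \<le> q n" if "n < m" for n
    using not_less_Least[of n "\<lambda>n. q n < e"] that unfolding m_def by simp
  then have "record_index m"
    unfolding record_index_def using m by (metis le_less less_eq_real_def less_le_trans)
  moreover have "m \<ge> N"
  proof (rule ccontr)
    assume "\<not> m \<ge> N"
    then have "e \<le> q m" unfolding e_def by (intro Min_le) auto
    then show False using m by simp
  qed
  ultimately show ?thesis by blast
qed

text \<open>
  For a solution \<open>z\<close>, subtracting the accumulated bounds of the cross terms from the decreasing \<open>B k z\<close> gives a sequence whose
  decrease from \<open>k\<close> to \<open>m\<close> controls \<open>B k (x m)\<close>. It still converges, as \<open>q\<close> is summable.
\<close>

definition E :: "'a \<Rightarrow> nat \<Rightarrow> real" where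
  "E z k = B k z - \<mu>1 * (\<Sum>i<k. q i)"

text \<open>
  At a record index \<open>m\<close> the bound of the cross term between \<open>i\<close> and \<open>m\<close> depends on \<open>i\<close> only,
  namely on \<open>q i\<close>, so the sum over \<open>i\<close> telescopes into \<open>E\<close>.
\<close>

lemma B_record:
  assumes z: "A z = y" and m: "record_index m" "k \<le> m"
  shows "B k (x m) \<le> E z k - E z m"
proof -
  have "(\<xi> m - \<xi> k) \<bullet> (x m - z) = - (\<Sum>i=k..<m. t i * (v i \<bullet> (A (x m) - y)))"
    using inner_\<xi>_diff[OF m(2)] z by (simp add: blinfun.diff_right)
  also have "\<dots> \<le> (\<Sum>i=k..<m. \<mu>1 * q i)"
    unfolding sum_negf[symmetric]
  proof (rule sum_mono)
    fix i assume i: "i \<in> {k..<m}"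
    have le: "\<bar>v i \<bullet> (A (x m) - y)\<bar> \<le> q i"
    proof -
      have "q m \<le> q i" using m(1) i by (simp add: record_index_def)
      moreover have "p i \<le> q i" "p m \<le> q m" by (simp_all add: q_def)
      ultimately show ?thesis using cross_term[of i m] i by simp
    qed
    have "- (t i * (v i \<bullet> (A (x m) - y))) \<le> t i * \<bar>v i \<bullet> (A (x m) - y)\<bar>"
      using mult_left_mono[OF abs_ge_minus_self, of "t i" "v i \<bullet> (A (x m) - y)"] t_lower[of i] \<tau>
      by simp
    also have "\<dots> \<le> \<mu>1 * q i"
      using t_upper[of i] t_lower[of i] \<tau> le by (intro mult_mono) auto
    finally show "- (t i * (v i \<bullet> (A (x m) - y))) \<le> \<mu>1 * q i" .
  qed
  also have "\<dots> = \<mu>1 * (\<Sum>i<m. q i) - \<mu>1 * (\<Sum>i<k. q i)"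
    using sum_diff_nat_ivl[of 0 k m q] m(2)
    by (simp add: sum_distrib_left[symmetric] atLeast0LessThan right_diff_distrib[symmetric])
  finally show ?thesis using B_iterates[of k m z] by (simp add: E_def)
qed

lemma E_decseq:
  assumes z: "A z = y"
  shows "decseq (E z)"
proof (rule decseq_SucI)
  fix n
  have "0 \<le> (1 - \<mu>0 / (4 * c0)) * \<tau> * p n"
    using \<mu>0 c0 \<tau> p_nonneg[of n] by simp
  moreover have "0 \<le> \<mu>1 * q n"
    using \<tau> t_lower[of 0] t_upper[of 0] q_pos[of n] by simp
  ultimately show "E z (Suc n) \<le> E z n"
    using B_descent[OF z, of n] by (simp add: E_def algebra_simps)
qed

text \<open>
  Two late iterates are compared through a common record index beyond both, which makes the full
  sequence, and not only the subsequence of records, a Cauchy sequence. The limit lies in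
  each closed set \<open>{z \<in> D. B k z \<le> \<epsilon> k}\<close>, because that set contains all later record iterates.
\<close>

lemma iterates_converge:
  assumes z: "z \<in> D" "A z = y"
  obtains u \<epsilon> where "u \<in> D" "A u = y" "\<And>k. B k u \<le> \<epsilon> k" "\<epsilon> \<longlonglongrightarrow> 0"
proof -
  have p: "summable p" by (rule summable_p[OF z])
  have \<mu>1: "\<mu>1 > 0" using \<tau> t_lower[of 0] t_upper[of 0] by simp
  have "- (\<mu>1 * suminf q) \<le> E z n" for n
  proof -
    have "(\<Sum>i<n. q i) \<le> suminf q"
      using q_pos by (intro sum_le_suminf summable_q p) (auto simp: less_imp_le)
    then have "\<mu>1 * (\<Sum>i<n. q i) \<le> \<mu>1 * suminf q" using \<mu>1 by simp
    then show ?thesis using B_nonneg[OF z(1), of n] by (simp add: E_def)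
  qed
  then obtain L where L: "E z \<longlonglongrightarrow> L" "\<And>n. L \<le> E z n"
    using decseq_convergent[OF E_decseq[OF z(2)]] by blast
  define \<epsilon> where "\<epsilon> k = E z k - L" for k
  have \<epsilon>: "\<epsilon> \<longlonglongrightarrow> 0"
    using tendsto_diff[OF L(1) tendsto_const[of L]] by (simp add: \<epsilon>_def[abs_def])
  have rec: "B k (x m) \<le> \<epsilon> k" if "record_index m" "k \<le> m" for k m
    using B_record[OF z(2) that] L(2)[of m] by (simp add: \<epsilon>_def)
  have "Cauchy x"
  proof (rule CauchyI)
    fix e :: real assume e: "e > 0"
    then have "\<forall>\<^sub>F n in sequentially. \<epsilon> n < c0 * (e/2)\<^sup>2"
      using \<epsilon> c0 by (intro order_tendstoD(2)) auto
    then obtain N where N: "\<And>n. n \<ge> N \<Longrightarrow> \<epsilon> n < c0 * (e/2)\<^sup>2"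
      unfolding eventually_sequentially by blast
    have close: "norm (x m - x n) < e/2" if "record_index m" "n \<le> m" "n \<ge> N" for m n
    proof -
      have "c0 * (norm (x m - x n))\<^sup>2 < c0 * (e/2)\<^sup>2"
        using B_growth[OF x_in, of m n] rec[OF that(1,2)] N[OF that(3)] by linarith
      then show ?thesis
        using c0 e power_less_imp_less_base[of "norm (x m - x n)" 2 "e/2"] by simp
    qed
    have "norm (x j - x n) < e" if jn: "j \<ge> N" "n \<ge> N" for j n
    proof -
      obtain m where "m \<ge> max j n" "record_index m" using record_index_exists[OF p] by blast
      then have "norm (x m - x j) < e/2" "norm (x m - x n) < e/2" using close jn by auto
      then show ?thesis
        using norm_triangle_ineq4[of "x m - x n" "x m - x j"] by simp
    qed
    then show "\<exists>M. \<forall>m\<ge>M. \<forall>n\<ge>M. norm (x m - x n) < e" by blast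
  qed
  then obtain u where u: "x \<longlonglongrightarrow> u" using Cauchy_convergent convergent_def by blast
  have "(\<lambda>n. A (x n)) \<longlonglongrightarrow> A u" using u by (intro tendsto_intros)
  then have Au: "A u = y" using residual_tendsto_0[OF p] LIMSEQ_unique by blast
  have level: "u \<in> {z \<in> D. B k z \<le> \<epsilon> k}" for k
  proof -
    have "closed {z \<in> D. f z + (- f (x k) - \<xi> k \<bullet> (z - x k)) \<le> \<epsilon> k}"
      by (intro closed_sublevel_add_continuous closed_sublevel continuous_intros)
    then have cl: "closed {z \<in> D. B k z \<le> \<epsilon> k}" by (simp add: B_def algebra_simps)
    have "\<exists>w\<in>{z \<in> D. B k z \<le> \<epsilon> k}. dist w u < e" if e: "e > 0" for e
    proof -
      obtain N where N: "\<And>n. n \<ge> N \<Longrightarrow> dist (x n) u < e"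
        using u e unfolding lim_sequentially by blast
      obtain m where "m \<ge> max k N" "record_index m" using record_index_exists[OF p] by blast
      then show ?thesis using N rec x_in by (intro bexI[of _ "x m"]) auto
    qed
    then show ?thesis using closed_approachable[OF cl] by blast
  qed
  show ?thesis
    using that[of u \<epsilon>] level Au \<epsilon> by blast
qed

text \<open>
  Both \<open>z\<close> and the limit \<open>u\<close> of the iterates are solutions, and \<open>\<xi> k - \<xi> 0\<close> is orthogonal to
  \<open>z - u\<close>. So \<open>B k z - B k u = B 0 z - B 0 u \<le> 0\<close> for all \<open>k\<close>.
\<close>

theorem convergence_to_minimal_solution:
  assumes z: "z \<in> D" "A z = y" and minimal: "\<And>w. w \<in> D \<Longrightarrow> A w = y \<Longrightarrow> B 0 z \<le> B 0 w"
  shows "(\<lambda>n. B n z) \<longlonglongrightarrow> 0" and "(\<lambda>n. norm (x n - z)) \<longlonglongrightarrow> 0"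
proof -
  obtain u \<epsilon> where u: "u \<in> D" "A u = y" and B: "\<And>k. B k u \<le> \<epsilon> k" and \<epsilon>: "\<epsilon> \<longlonglongrightarrow> 0"
    using iterates_converge[OF z] by blast
  have "B k z \<le> \<epsilon> k" for k
  proof -
    have "(\<xi> k - \<xi> 0) \<bullet> (z - u) = 0"
      using inner_\<xi>_diff[of 0 k "z - u"] z u by (simp add: blinfun.diff_right)
    then have "B k z - B k u = B 0 z - B 0 u"
      by (simp add: B_def inner_diff_left inner_diff_right)
    then show ?thesis using minimal[OF u] B[of k] by linarith
  qed
  then show lim: "(\<lambda>n. B n z) \<longlonglongrightarrow> 0"
    using B_nonneg[OF z(1)] by (intro Lim_null_comparison[OF always_eventually[OF allI] \<epsilon>]) simp
  have "norm ((norm (x n - z))\<^sup>2) \<le> B n z / c0" for n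
    using B_growth[OF z(1), of n] c0 by (simp add: field_simps norm_minus_commute)
  moreover have "(\<lambda>n. B n z / c0) \<longlonglongrightarrow> 0" using tendsto_divide[OF lim tendsto_const, of c0] c0 by simp
  ultimately have "(\<lambda>n. (norm (x n - z))\<^sup>2) \<longlonglongrightarrow> 0"
    by (rule Lim_null_comparison[OF always_eventually[OF allI]])
  from tendsto_real_sqrt[OF this] show "(\<lambda>n. norm (x n - z)) \<longlonglongrightarrow> 0"
    by simp
qed

end

section \<open>Extended-real-valued functionals\<close>

lemma lower_semicontinuous_closed_sublevel:
  fixes \<Theta> :: "'a::topological_space \<Rightarrow> ereal"
  assumes "lower_semicontinuous \<Theta>"
  shows "closed {z. \<Theta> z \<le> b}"
  unfolding closed_def
proof (subst open_subopen, intro ballI)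
  fix z assume "z \<in> - {z. \<Theta> z \<le> b}"
  then have z: "b < \<Theta> z" by simp
  moreover have "\<Theta> z \<le> Liminf (at z) \<Theta>"
    using assms by (simp add: lower_semicontinuous_def)
  ultimately have "\<forall>\<^sub>F w in at z. b < \<Theta> w"
    by (simp add: le_Liminf_iff)
  then obtain S where "open S" "z \<in> S" "\<And>w. w \<in> S \<Longrightarrow> w \<noteq> z \<Longrightarrow> b < \<Theta> w"
    unfolding eventually_at_topological by blast
  then show "\<exists>T. open T \<and> z \<in> T \<and> T \<subseteq> - {z. \<Theta> z \<le> b}"
    using z by (intro exI[of _ S]) force
qed

lemma strongly_convex_imp_on:
  fixes \<Theta> :: "'a::real_normed_vector \<Rightarrow> ereal"
  assumes ninf: "\<forall>z. \<Theta> z \<noteq> -\<infinity>" and sc: "strongly_convex c \<Theta>"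
  shows "strongly_convex_on c (effective_domain \<Theta>) (\<lambda>z. real_of_ereal (\<Theta> z))"
  unfolding strongly_convex_on_def
proof (intro allI impI)
  fix s :: real and x' x :: 'a
  assume *: "0 \<le> s \<and> s \<le> 1 \<and> x' \<in> effective_domain \<Theta> \<and> x \<in> effective_domain \<Theta>"
  obtain a b where ab: "\<Theta> x' = ereal a" "\<Theta> x = ereal b"
    using * ninf by (cases "\<Theta> x'"; cases "\<Theta> x") (auto simp: effective_domain_def)
  let ?w = "s *\<^sub>R x' + (1 - s) *\<^sub>R x"
  have le: "\<Theta> ?w + ereal (c * s * (1 - s) * (norm (x' - x))\<^sup>2) \<le> ereal (s * a + (1 - s) * b)"
    using sc[unfolded strongly_convex_def, rule_format, of s x' x] * by (simp add: ab)
  then obtain w where w: "\<Theta> ?w = ereal w"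
    using ninf by (cases "\<Theta> ?w") auto
  show "?w \<in> effective_domain \<Theta> \<and>
      real_of_ereal (\<Theta> ?w) + c * s * (1 - s) * (norm (x' - x))\<^sup>2
        \<le> s * real_of_ereal (\<Theta> x') + (1 - s) * real_of_ereal (\<Theta> x)"
    using le by (simp add: w ab effective_domain_def)
qed

lemma strongly_convex_on_diff_inner:
  fixes f :: "'a::real_inner \<Rightarrow> real"
  assumes "strongly_convex_on c D f"
  shows "strongly_convex_on c D (\<lambda>z. f z - \<xi> \<bullet> z)"
  unfolding strongly_convex_on_def
proof (intro allI impI)
  fix s :: real and x' x :: 'a
  assume s: "0 \<le> s \<and> s \<le> 1 \<and> x' \<in> D \<and> x \<in> D"
  have "\<xi> \<bullet> (s *\<^sub>R x' + (1 - s) *\<^sub>R x) = s * (\<xi> \<bullet> x') + (1 - s) * (\<xi> \<bullet> x)"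
    by (simp add: inner_add_right)
  then show "s *\<^sub>R x' + (1 - s) *\<^sub>R x \<in> D \<and>
      f (s *\<^sub>R x' + (1 - s) *\<^sub>R x) - \<xi> \<bullet> (s *\<^sub>R x' + (1 - s) *\<^sub>R x)
          + c * s * (1 - s) * (norm (x' - x))\<^sup>2
        \<le> s * (f x' - \<xi> \<bullet> x') + (1 - s) * (f x - \<xi> \<bullet> x)"
    using strongly_convex_onD[OF assms, of s x' x] s by (auto simp: right_diff_distrib)
qed

lemma strongly_convex_on_Int:
  fixes f :: "'a::real_normed_vector \<Rightarrow> real"
  assumes "strongly_convex_on c D f" "convex C"
  shows "strongly_convex_on c (D \<inter> C) f"
  unfolding strongly_convex_on_def
proof (intro allI impI)
  fix s :: real and x' x :: 'a
  assume s: "0 \<le> s \<and> s \<le> 1 \<and> x' \<in> D \<inter> C \<and> x \<in> D \<inter> C"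
  then have "s *\<^sub>R x' + (1 - s) *\<^sub>R x \<in> C"
    using assms(2) by (intro convexD) auto
  then show "s *\<^sub>R x' + (1 - s) *\<^sub>R x \<in> D \<inter> C \<and>
      f (s *\<^sub>R x' + (1 - s) *\<^sub>R x) + c * s * (1 - s) * (norm (x' - x))\<^sup>2
        \<le> s * f x' + (1 - s) * f x"
    using strongly_convex_onD[OF assms(1), of s x' x] s by blast
qed

text \<open>
  The lower bound rests on \<open>(norm (adjoint A v))\<^sup>2 \<le> v \<bullet> r\<close>, which makes the quotient in the step-size rule at least
  \<open>\<mu>0\<close>.
\<close>

lemma step_size_bounds:
  assumes "v = reg_inverse A a r" and p: "(norm (adjoint A v))\<^sup>2 \<le> v \<bullet> r" and \<mu>: "0 < \<mu>0" "0 < \<mu>1"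
  shows "min \<mu>0 \<mu>1 \<le> step_size A \<mu>0 \<mu>1 a r" and "step_size A \<mu>0 \<mu>1 a r \<le> \<mu>1"
    and "step_size A \<mu>0 \<mu>1 a r * (norm (adjoint A v))\<^sup>2 \<le> \<mu>0 * (v \<bullet> r)"
proof -
  define N where "N = (norm (adjoint A v))\<^sup>2"
  have t: "step_size A \<mu>0 \<mu>1 a r = (if N = 0 then \<mu>1 else min (\<mu>0 * (v \<bullet> r) / N) \<mu>1)"
    by (simp add: step_size_def assms(1) N_def)
  have N: "0 \<le> N" "N \<le> v \<bullet> r" using p by (simp_all add: N_def)
  show "step_size A \<mu>0 \<mu>1 a r \<le> \<mu>1" by (simp add: t)
  show "min \<mu>0 \<mu>1 \<le> step_size A \<mu>0 \<mu>1 a r"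
  proof (cases "N = 0")
    case False
    then have "\<mu>0 \<le> \<mu>0 * (v \<bullet> r) / N" using N \<mu> by (simp add: field_simps)
    then show ?thesis by (auto simp: t)
  qed (simp add: t)
  show "step_size A \<mu>0 \<mu>1 a r * (norm (adjoint A v))\<^sup>2 \<le> \<mu>0 * (v \<bullet> r)"
  proof (cases "N = 0")
    case False
    then have "step_size A \<mu>0 \<mu>1 a r * N \<le> \<mu>0 * (v \<bullet> r) / N * N"
      using N by (intro mult_right_mono) (auto simp: t)
    then show ?thesis using False by (simp add: N_def)
  next
    case True
    then show ?thesis using N \<mu> by (simp add: N_def)
  qed
qed

locale convex_penalty =
  fixes \<Theta> :: "'a::{real_inner, banach} \<Rightarrow> ereal" and c :: real
  assumes not_MInf: "\<forall>z. \<Theta> z \<noteq> -\<infinity>" and proper: "proper_functional \<Theta>"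
    and lsc: "lower_semicontinuous \<Theta>" and c_pos: "c > 0" and sc: "strongly_convex c \<Theta>"
begin

abbreviation D :: "'a set" where "D \<equiv> effective_domain \<Theta>"

definition f :: "'a \<Rightarrow> real" where "f z = real_of_ereal (\<Theta> z)"

lemma \<Theta>_eq: "z \<in> D \<Longrightarrow> \<Theta> z = ereal (f z)"
  using not_MInf unfolding f_def effective_domain_def
  by (cases "\<Theta> z") auto

lemma \<Theta>_outside: "z \<notin> D \<Longrightarrow> \<Theta> z = \<infinity>"
  by (simp add: effective_domain_def)

lemma closed_sublevel: "closed {z \<in> D. f z \<le> b}"
proof -
  have "{z \<in> D. f z \<le> b} = {z. \<Theta> z \<le> ereal b}"
  proof (intro Collect_cong)
    show "z \<in> D \<and> f z \<le> b \<longleftrightarrow> \<Theta> z \<le> ereal b" for z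
      by (cases "z \<in> D") (simp_all add: \<Theta>_eq \<Theta>_outside)
  qed
  then show ?thesis using lower_semicontinuous_closed_sublevel[OF lsc] by simp
qed

lemma strongly_convex_on_f: "strongly_convex_on c D f"
  using strongly_convex_imp_on[OF not_MInf sc] by (simp add: f_def[abs_def])

text \<open>
  The case \<open>C = UNIV\<close> gives the primal iterates; the case of the solution set of \<open>A z = y\<close> gives the
  Bregman-minimal solution. The growth term yields uniqueness in both.
\<close>

lemma tilted_minimiser:
  assumes C: "closed C" "convex C" "D \<inter> C \<noteq> {}"
  obtains m where "m \<in> D" "m \<in> C"
    "\<And>z. z \<in> D \<Longrightarrow> z \<in> C \<Longrightarrow> f m - \<xi> \<bullet> m + c * (norm (z - m))\<^sup>2 \<le> f z - \<xi> \<bullet> z"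
proof -
  have conv: "strongly_convex_on c (D \<inter> C) (\<lambda>z. f z - \<xi> \<bullet> z)"
    using strongly_convex_on_diff_inner[OF strongly_convex_on_f, of \<xi>]
    by (rule strongly_convex_on_Int[OF _ C(2)])
  have "closed {z \<in> D \<inter> C. f z - \<xi> \<bullet> z \<le> b}" for b
  proof -
    have "closed ({z \<in> D. f z + - (\<xi> \<bullet> z) \<le> b} \<inter> C)"
      by (intro closed_Int C closed_sublevel_add_continuous closed_sublevel continuous_intros)
    moreover have "{z \<in> D. f z + - (\<xi> \<bullet> z) \<le> b} \<inter> C = {z \<in> D \<inter> C. f z - \<xi> \<bullet> z \<le> b}"
      by auto
    ultimately show ?thesis by simp
  qed
  then obtain m where m: "m \<in> D \<inter> C" "\<And>z. z \<in> D \<inter> C \<Longrightarrow> f m - \<xi> \<bullet> m \<le> f z - \<xi> \<bullet> z"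
    using strongly_convex_on_minimiser[OF c_pos conv C(3)] by blast
  then show ?thesis
    using that[of m] strongly_convex_on_growth[OF conv m] by blast
qed

lemma primal_min_growth:
  shows "primal_min \<Theta> \<xi> \<in> D"
    and "z \<in> D \<Longrightarrow> f (primal_min \<Theta> \<xi>) + \<xi> \<bullet> (z - primal_min \<Theta> \<xi>)
        + c * (norm (z - primal_min \<Theta> \<xi>))\<^sup>2 \<le> f z"
proof -
  have ne: "D \<inter> UNIV \<noteq> {}" using proper by (simp add: proper_functional_def)
  obtain m where m: "m \<in> D"
      "\<And>z. z \<in> D \<Longrightarrow> f m - \<xi> \<bullet> m + c * (norm (z - m))\<^sup>2 \<le> f z - \<xi> \<bullet> z"
    using tilted_minimiser[OF _ _ ne, of \<xi>] by auto
  have le: "f m - \<xi> \<bullet> m \<le> f z - \<xi> \<bullet> z" if "z \<in> D" for z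
  proof -
    have "0 \<le> c * (norm (z - m))\<^sup>2" using c_pos by simp
    then show ?thesis using m(2)[OF that] by linarith
  qed
  have arg: "is_arg_min (\<lambda>x. \<Theta> x - ereal (\<xi> \<bullet> x)) (\<lambda>_. True) m"
    unfolding is_arg_min_def
  proof (intro conjI notI TrueI, elim exE conjE)
    fix z assume less: "\<Theta> z - ereal (\<xi> \<bullet> z) < \<Theta> m - ereal (\<xi> \<bullet> m)"
    show False
    proof (cases "z \<in> D")
      case True
      then show ?thesis using less le[OF True] m(1) by (simp add: \<Theta>_eq)
    next
      case False
      then show ?thesis using less by (simp add: \<Theta>_outside)
    qed
  qed
  have "w = m" if w: "is_arg_min (\<lambda>x. \<Theta> x - ereal (\<xi> \<bullet> x)) (\<lambda>_. True) w" for w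
  proof -
    have not_less: "\<not> \<Theta> m - ereal (\<xi> \<bullet> m) < \<Theta> w - ereal (\<xi> \<bullet> w)"
      using w by (auto simp: is_arg_min_def)
    then have wD: "w \<in> D" using m(1) \<Theta>_eq \<Theta>_outside by (cases "w \<in> D") auto
    then have "f w - \<xi> \<bullet> w \<le> f m - \<xi> \<bullet> m" using not_less m(1) by (simp add: \<Theta>_eq)
    then have "c * (norm (w - m))\<^sup>2 \<le> 0" using m(2)[OF wD] by linarith
    then show ?thesis using c_pos by (simp add: mult_le_0_iff)
  qed
  then have "primal_min \<Theta> \<xi> = m"
    unfolding primal_min_def arg_min_def using arg by (rule some_equality[rotated])
  then show "primal_min \<Theta> \<xi> \<in> D"
    "z \<in> D \<Longrightarrow> f (primal_min \<Theta> \<xi>) + \<xi> \<bullet> (z - primal_min \<Theta> \<xi>)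
        + c * (norm (z - primal_min \<Theta> \<xi>))\<^sup>2 \<le> f z"
    using m(1) m(2)[of z] by (simp_all add: inner_diff_right)
qed

lemma bregman_eq:
  assumes "z \<in> D" "x \<in> D"
  shows "bregman \<Theta> \<xi> z x = ereal (f z - f x - \<xi> \<bullet> (z - x))"
  using assms by (simp add: bregman_def \<Theta>_eq)

text \<open>
  On \<open>D\<close> the Bregman distance from \<open>x0\<close> differs from \<open>\<lambda>z. f z - \<xi>0 \<bullet> z\<close> by a constant, and outside \<open>D\<close>
  it is infinite. So the minimisers of both functions over the solution set agree, and the definite
  description denotes the one found above.
\<close>

lemma bregman_solution_minimal:
  fixes A :: "'a \<Rightarrow>\<^sub>L 'b::{real_inner, banach}" and \<xi>0 :: 'a
  assumes ex: "\<exists>z\<in>D. A z = y" and x0: "x0 \<in> D"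
  defines "u \<equiv> bregman_solution A y \<Theta> \<xi>0 x0"
  shows "u \<in> D" "A u = y"
    and "\<And>w. w \<in> D \<Longrightarrow> A w = y \<Longrightarrow> f u - \<xi>0 \<bullet> u \<le> f w - \<xi>0 \<bullet> w"
proof -
  let ?P = "\<lambda>x. x \<in> D \<and> is_arg_min (\<lambda>z. bregman \<Theta> \<xi>0 z x0) (\<lambda>z. A z = y) x"
  let ?C = "{z. A z = y}"
  have "closed ?C" by (intro closed_Collect_eq continuous_intros)
  moreover have "convex ?C"
    using convex_linear_vimage[OF bounded_linear.linear[OF blinfun.bounded_linear_right], of "{y}" A] by (simp add: vimage_def)
  moreover have "D \<inter> ?C \<noteq> {}" using ex by blast
  ultimately obtain m where m': "m \<in> D" "m \<in> ?C"
      "\<And>z. z \<in> D \<Longrightarrow> z \<in> ?C \<Longrightarrow> f m - \<xi>0 \<bullet> m + c * (norm (z - m))\<^sup>2 \<le> f z - \<xi>0 \<bullet> z"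
    by (rule tilted_minimiser) (rule that)
  then have m: "m \<in> D" "A m = y"
      "\<And>z. z \<in> D \<Longrightarrow> A z = y \<Longrightarrow> f m - \<xi>0 \<bullet> m + c * (norm (z - m))\<^sup>2 \<le> f z - \<xi>0 \<bullet> z"
    by auto
  have le: "f m - \<xi>0 \<bullet> m \<le> f z - \<xi>0 \<bullet> z" if "z \<in> D" "A z = y" for z
  proof -
    have "0 \<le> c * (norm (z - m))\<^sup>2" using c_pos by simp
    then show ?thesis using m(3)[OF that] by linarith
  qed
  have "?P m"
    unfolding is_arg_min_def
  proof (intro conjI notI m, elim exE conjE)
    fix z assume Az: "A z = y" and less: "bregman \<Theta> \<xi>0 z x0 < bregman \<Theta> \<xi>0 m x0"
    show False
    proof (cases "z \<in> D")
      case True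
      then show ?thesis
        using less le[OF True Az] m(1) x0 by (simp add: bregman_eq inner_diff_right)
    next
      case False
      then show ?thesis using less x0 by (simp add: bregman_def \<Theta>_outside \<Theta>_eq)
    qed
  qed
  moreover have "w = m" if w: "?P w" for w
  proof -
    have "\<not> bregman \<Theta> \<xi>0 m x0 < bregman \<Theta> \<xi>0 w x0" and Aw: "A w = y"
      using w m(2) by (auto simp: is_arg_min_def)
    then have "f w - \<xi>0 \<bullet> w \<le> f m - \<xi>0 \<bullet> m"
      using w m(1) x0 by (simp add: bregman_eq inner_diff_right)
    then have "c * (norm (w - m))\<^sup>2 \<le> 0" using m(3)[of w] w Aw by auto
    then show ?thesis using c_pos by (simp add: mult_le_0_iff)
  qed
  ultimately have "u = m" unfolding u_def bregman_solution_def by (rule the_equality)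
  then show "u \<in> D" "A u = y"
    "\<And>w. w \<in> D \<Longrightarrow> A w = y \<Longrightarrow> f u - \<xi>0 \<bullet> u \<le> f w - \<xi>0 \<bullet> w"
    using m(1,2) le by auto
qed

end

theorem theorem2p2:
  fixes A :: "'a::{real_inner, banach} \<Rightarrow>\<^sub>L 'b::{real_inner, banach}"
    and y :: 'b
    and \<Theta> :: "'a \<Rightarrow> ereal"
    and c0 \<mu>0 \<mu>1 :: real
    and \<alpha> :: "nat \<Rightarrow> real"
    and \<xi>0 xdag :: 'a
    and \<xi> x :: "nat \<Rightarrow> 'a"
  assumes "\<forall>z. \<Theta> z \<noteq> -\<infinity>"
    and "proper_functional \<Theta>"
    and "lower_semicontinuous \<Theta>"
    and "c0 > 0"
    and "strongly_convex c0 \<Theta>"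
    and "\<exists>z \<in> effective_domain \<Theta>. A z = y"
    and "decseq \<alpha>"
    and "\<forall>n. \<alpha> n > 0"
    and "0 < \<mu>0" and "\<mu>0 < 4 * c0"
    and "\<mu>1 > 0"
    and "\<xi> 0 = \<xi>0"
    and "\<forall>n. x n = primal_min \<Theta> (\<xi> n)"
    and "\<forall>n. \<xi> (Suc n) = \<xi> n -
           step_size A \<mu>0 \<mu>1 (\<alpha> n) (A (x n) - y) *\<^sub>R
             adjoint A (reg_inverse A (\<alpha> n) (A (x n) - y))"
    and "xdag = bregman_solution A y \<Theta> \<xi>0 (x 0)"
  shows "((\<lambda>n. norm (x n - xdag)) \<longlonglongrightarrow> 0) \<and>
         ((\<lambda>n. bregman \<Theta> (\<xi> n) xdag (x n)) \<longlonglongrightarrow> 0)"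
proof -
  interpret pen: convex_penalty \<Theta> c0
    using assms(1-5) by unfold_locales
  define r where "r n = A (x n) - y" for n
  define v where "v n = reg_inverse A (\<alpha> n) (r n)" for n
  define t where "t n = step_size A \<mu>0 \<mu>1 (\<alpha> n) (r n)" for n
  have x: "x n = primal_min \<Theta> (\<xi> n)" for n using assms(13) by blast
  have v_eq: "\<alpha> n *\<^sub>R v n + A (adjoint A (v n)) = r n" for n
    using reg_inverse_eq[of "\<alpha> n" A "r n"] assms(8) by (simp add: v_def)
  have "(norm (adjoint A (v n)))\<^sup>2 \<le> v n \<bullet> r n" for n
  proof -
    have "v n \<bullet> r n = \<alpha> n * (norm (v n))\<^sup>2 + (norm (adjoint A (v n)))\<^sup>2"
      unfolding v_eq[symmetric]
      by (simp add: inner_add_right inner_commute[of "v n" "A _"] inner_adjoint_blinfun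
          power2_norm_eq_inner)
    moreover have "0 \<le> \<alpha> n * (norm (v n))\<^sup>2" using assms(8) by (simp add: less_imp_le)
    ultimately show ?thesis by linarith
  qed
  then have t: "min \<mu>0 \<mu>1 \<le> t n" "t n \<le> \<mu>1"
      "t n * (norm (adjoint A (v n)))\<^sup>2 \<le> \<mu>0 * (v n \<bullet> r n)" for n
    using step_size_bounds[OF v_def, of n \<mu>0 \<mu>1] assms(9,11) by (simp_all only: t_def)
  interpret it: dual_gradient_iteration A y pen.D pen.f c0 \<mu>0 \<mu>1 "min \<mu>0 \<mu>1" \<alpha> t \<xi> x v
  proof unfold_locales
    show "\<xi> (Suc n) = \<xi> n - t n *\<^sub>R adjoint A (v n)" for n
      using assms(14) by (simp add: t_def v_def r_def)
  qed (use assms(4,7-11) t v_eq pen.closed_sublevel pen.primal_min_growth in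
      \<open>auto simp: x r_def\<close>)
  have xdag_eq: "xdag = bregman_solution A y \<Theta> (\<xi> 0) (x 0)" using assms(12,15) by simp
  note sol = pen.bregman_solution_minimal[OF assms(6) it.x_in[of 0]]
  have xdag: "xdag \<in> pen.D" "A xdag = y" unfolding xdag_eq by (rule sol)+
  have min: "pen.f xdag - \<xi> 0 \<bullet> xdag \<le> pen.f w - \<xi> 0 \<bullet> w" if "w \<in> pen.D" "A w = y" for w
    unfolding xdag_eq using that by (rule sol(3))
  have "it.B 0 xdag \<le> it.B 0 w" if "w \<in> pen.D" "A w = y" for w
    using min[OF that] by (simp add: it.B_def inner_diff_right)
  note conv = it.convergence_to_minimal_solution[OF xdag this]
  have "bregman \<Theta> (\<xi> n) xdag (x n) = ereal (it.B n xdag)" for n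
    using pen.bregman_eq[OF xdag(1) it.x_in] by (simp add: it.B_def)
  moreover have "(\<lambda>n. ereal (it.B n xdag)) \<longlonglongrightarrow> ereal 0"
    using conv(1) by (intro tendsto_ereal)
  ultimately show ?thesis using conv(2) by (simp add: zero_ereal_def)
qed

end
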